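(* The sequence $(\pi_N)_{N\in\mathbb{N}}$ of invariant measures satisfies a large deviations principle (with speed $N$, on the finite set $V$) with rate functional $$\mathscr{FW}(x):=\lim_{N\to+\infty}-\frac1N\log\pi_N(x)=\min_{\tau\in\mathcal{T}_x}\Delta(\tau)-\min_{\tau\in\mathcal{T}}\Delta(\tau),\qquad x\in V.$$ Moreover, $\mathscr{FW}$ is a solution of the discrete Hamilton–Jacobi equation $$W(x)+\min_{y:(x,y)\in E}\Delta(x,y)=\min_{y:(y,x)\in E}\{W(y)+\Delta(y,x)\}\qquad\forall x\in V.$$
   Context: $\mathcal{G}=(V,E)$ is a finite, strongly connected directed graph without loops. For each $N\in\mathbb{N}$ consider the irreducible continuous-time Markov chain on $V$ with jump rates $r_N(x,y)>0$, $(x,y)\in E$. Standing assumption: for every $(x,y)\in E$ the limit $\Delta(x,y):=-\lim_{N\to+\infty}N^{-1}\log r_N(x,y)$ exists, is finite and is $\ge0$. $\pi_N$ is the unique invariant probability measure of the chain, i.e. the unique probability on $V$ with $\pi_N(x)\sum_{y:(x,y)\in E}r_N(x,y)=\sum_{y:(y,x)\in E}\pi_N(y)r_N(y,x)$ for all $x\in V$. By the Markov chain Matrix Tree Theorem, $\pi_N(x)=\frac{\sum_{\tau\in\mathcal{T}_x}\prod_{e\in\tau}r_N(e)}{\sum_{\tau\in\mathcal{T}}\prod_{e\in\tau}r_N(e)}$. An arborescence directed toward $x\in V$ is a spanning subgraph $\tau$ of $\mathcal{G}$ such that each vertex $y\ne x$ has exactly one exiting edge in $\tau$, there is no edge of $\tau$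 exiting from $x$, and from every $y\in V$ there is a unique directed path in $\tau$ to $x$. $\mathcal{T}_x$ is the set of arborescences of $\mathcal{G}$ directed toward $x$, $\mathcal{T}=\bigcup_{x\in V}\mathcal{T}_x$, and $\Delta(\tau):=\sum_{e\in\tau}\Delta(e)$. *)

theory Defs
  imports "HOL-Probability.Probability" "Graph_Theory.Graph_Theory"
begin

definition arborescences :: "'a pair_pre_digraph \<Rightarrow> 'a \<Rightarrow> 'a pair_pre_digraph set" where
  "arborescences G x =
     {\<tau>. spanning (with_proj \<tau>) (with_proj G) \<and>
         (\<forall>y \<in> pverts G - {x}. \<exists>!e. e \<in> out_arcs (with_proj \<tau>) y) \<and>
         out_arcs (with_proj \<tau>) x = {} \<and>
         (\<forall>y \<in> pverts G. \<exists>!p. pre_digraph.apath (with_proj \<tau>) y p x)}"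

definition all_arborescences :: "'a pair_pre_digraph \<Rightarrow> 'a pair_pre_digraph set" where
  "all_arborescences G = (\<Union>x \<in> pverts G. arborescences G x)"

definition total_weight :: "('a \<times> 'a \<Rightarrow> real) \<Rightarrow> 'a pair_pre_digraph \<Rightarrow> real" where
  "total_weight \<Delta> \<tau> = (\<Sum>e \<in> parcs \<tau>. \<Delta> e)"

definition invariant_measure ::
    "'a pair_pre_digraph \<Rightarrow> ('a \<times> 'a \<Rightarrow> real) \<Rightarrow> 'a pmf \<Rightarrow> bool" where
  "invariant_measure G r \<mu> \<longleftrightarrow>
     set_pmf \<mu> \<subseteq> pverts G \<and>
     (\<forall>x \<in> pverts G.
        pmf \<mu> x * (\<Sum>y | (x, y) \<in> parcs G. r (x, y)) =
        (\<Sum>y | (y, x) \<in> parcs G. pmf \<mu> y * r (y, x)))"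

text \<open>The library's real logarithm satisfies \<open>ln 0 = 0\<close>; a large deviations principle needs
  \<open>log 0 = -\<infinity>\<close>.\<close>

definition elog :: "real \<Rightarrow> ereal" where
  "elog p = (if p = 0 then -\<infinity> else ereal (ln p))"

definition rate_functional :: "'a topology \<Rightarrow> ('a \<Rightarrow> ereal) \<Rightarrow> bool" where
  "rate_functional X I \<longleftrightarrow>
     (\<forall>x \<in> topspace X. 0 \<le> I x) \<and>
     (\<forall>c::real. closedin X {x \<in> topspace X. I x \<le> ereal c})"

text \<open>Large deviations principle with speed \<open>a\<close> for discrete probability measures carried by the
  space \<open>X\<close>. The infimum over the empty set is \<open>\<infinity>\<close>.\<close>

definition large_deviations_principle ::
    "'a topology \<Rightarrow> (nat \<Rightarrow> real) \<Rightarrow> (nat \<Rightarrow> 'a pmf) \<Rightarrow> ('a \<Rightarrow> ereal) \<Rightarrow> bool" where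
  "large_deviations_principle X a \<mu> I \<longleftrightarrow>
     rate_functional X I \<and>
     filterlim a at_top sequentially \<and>
     (\<forall>N. set_pmf (\<mu> N) \<subseteq> topspace X) \<and>
     (\<forall>C. closedin X C \<longrightarrow>
        limsup (\<lambda>N. ereal (1 / a N) * elog (measure_pmf.prob (\<mu> N) C)) \<le> - (INF x\<in>C. I x)) \<and>
     (\<forall>U. openin X U \<longrightarrow>
        - (INF x\<in>U. I x) \<le> liminf (\<lambda>N. ereal (1 / a N) * elog (measure_pmf.prob (\<mu> N) U)))"

definition FW :: "(nat \<Rightarrow> 'a pmf) \<Rightarrow> 'a \<Rightarrow> real" where
  "FW \<pi> x = lim (\<lambda>N. - (1 / real N) * ln (pmf (\<pi> N) x))"

text \<open>The minima are over nonempty sets unless the graph is a single vertex, in which case both are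
  minima of the empty set and hence the same (unspecified) real number.\<close>

definition solves_discrete_HJ ::
    "'a pair_pre_digraph \<Rightarrow> ('a \<times> 'a \<Rightarrow> real) \<Rightarrow> ('a \<Rightarrow> real) \<Rightarrow> bool" where
  "solves_discrete_HJ G \<Delta> W \<longleftrightarrow>
     (\<forall>x \<in> pverts G.
        W x + Min {\<Delta> (x, y) | y. (x, y) \<in> parcs G} =
        Min {W y + \<Delta> (y, x) | y. (y, x) \<in> parcs G})"

end

theory Submission
  imports Defs
begin

text \<open>
  The invariant measure is proportional to the tree weights: adding an edge out of \<open>x\<close> to an
  arborescence rooted at \<open>x\<close>, or adding an edge \<open>(y, x)\<close> to an arborescence rooted at \<open>y\<close>, both
  produce each functional graph whose only cycle passes through \<open>x\<close> exactly once, so the tree weights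
  satisfy the balance equations; and positive solutions of the balance equations are unique up to
  a factor by irreducibility. All quantities are thus built from the rates by sums, products and
  quotients, and under \<open>- (1 / N) log\<close> these turn into minima, sums and differences. The
  Hamilton--Jacobi equation is the image of the balance equation under this limit.
\<close>

section \<open>Logarithmic asymptotics\<close>

text \<open>This says \<open>f N = exp (- N * (l + o(1)))\<close>. Positivity is demanded at every
  index so that logarithms of products split exactly, without exceptional indices. At
  \<open>N = 0\<close> the prefactor \<open>1 / real N\<close> is 0 by convention.\<close>

definition exp_decay :: "(nat \<Rightarrow> real) \<Rightarrow> real \<Rightarrow> bool" where
  "exp_decay f l \<longleftrightarrow> (\<forall>N. 0 < f N) \<and> (\<lambda>N. - (1 / real N) * ln (f N)) \<longlonglongrightarrow> l"

lemma exp_decay_unique: "exp_decay f l \<Longrightarrow> exp_decay f l' \<Longrightarrow> l = l'"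
  unfolding exp_decay_def by (blast intro: LIMSEQ_unique)

lemma exp_decay_one: "exp_decay (\<lambda>_. 1) 0"
  by (simp add: exp_decay_def)

lemma exp_decay_mult:
  assumes "exp_decay f a" "exp_decay g b"
  shows "exp_decay (\<lambda>N. f N * g N) (a + b)"
proof -
  have pos: "0 < f N" "0 < g N" for N
    using assms by (auto simp: exp_decay_def)
  have "(\<lambda>N. - (1 / real N) * ln (f N) + - (1 / real N) * ln (g N)) \<longlonglongrightarrow> a + b"
    using assms by (intro tendsto_add) (auto simp: exp_decay_def)
  moreover have "- (1 / real N) * ln (f N * g N) = - (1 / real N) * ln (f N) + - (1 / real N) * ln (g N)" for N
    unfolding ln_mult_pos[OF pos] by (simp only: distrib_left)
  ultimately show ?thesis
    using pos by (simp add: exp_decay_def)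
qed

lemma exp_decay_inverse:
  assumes "exp_decay f a"
  shows "exp_decay (\<lambda>N. inverse (f N)) (- a)"
proof -
  have pos: "0 < f N" for N
    using assms by (auto simp: exp_decay_def)
  have "(\<lambda>N. - (- (1 / real N) * ln (f N))) \<longlonglongrightarrow> - a"
    using assms by (intro tendsto_minus) (auto simp: exp_decay_def)
  then show ?thesis
    using pos by (simp add: exp_decay_def ln_inverse)
qed

lemma exp_decay_divide:
  assumes "exp_decay f a" "exp_decay g b"
  shows "exp_decay (\<lambda>N. f N / g N) (a - b)"
  using exp_decay_mult[OF assms(1) exp_decay_inverse[OF assms(2)]]
  by (simp add: divide_inverse)

lemma exp_decay_prod:
  assumes "finite A" "\<And>i. i \<in> A \<Longrightarrow> exp_decay (\<lambda>N. f N i) (l i)"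
  shows "exp_decay (\<lambda>N. \<Prod>i\<in>A. f N i) (\<Sum>i\<in>A. l i)"
  using assms by (induction rule: finite_induct) (auto intro: exp_decay_mult exp_decay_one)

text \<open>The sum lies between the larger summand and twice the larger summand, and the factor 2
  only costs \<open>ln 2 / real N\<close>, which vanishes in the limit. The larger summand is the
  one with the smaller rate.\<close>

lemma exp_decay_add:
  assumes "exp_decay f a" "exp_decay g b"
  shows "exp_decay (\<lambda>N. f N + g N) (min a b)"
proof -
  have pos: "0 < f N" "0 < g N" for N
    using assms by (auto simp: exp_decay_def)
  define m where "m N = min (- (1 / real N) * ln (f N)) (- (1 / real N) * ln (g N))" for N
  have m: "m \<longlonglongrightarrow> min a b"
    unfolding m_def using assms by (intro tendsto_min) (auto simp: exp_decay_def)
  \<comment> \<open>The minus sign turns the minimum of the two rates into the logarithm of the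
    maximum.\<close>
  have m_eq: "m N = - (1 / real N) * ln (max (f N) (g N))" for N
  proof (cases "f N \<le> g N")
    case True
    then have "ln (f N) \<le> ln (g N)" using pos by simp
    then have "1 / real N * ln (f N) \<le> 1 / real N * ln (g N)" by (intro mult_left_mono) auto
    then show ?thesis using True by (simp add: m_def)
  next
    case False
    then have "ln (g N) \<le> ln (f N)" using pos by simp
    then have "1 / real N * ln (g N) \<le> 1 / real N * ln (f N)" by (intro mult_left_mono) auto
    then show ?thesis using False by (simp add: m_def)
  qed
  have "(\<lambda>N. - (1 / real N) * ln (f N + g N)) \<longlonglongrightarrow> min a b"
  proof (rule tendsto_sandwich)
    have "(\<lambda>N. m N - ln 2 / real N) \<longlonglongrightarrow> min a b - 0"
      by (intro tendsto_diff m lim_const_over_n)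
    then show "(\<lambda>N. m N - ln 2 / real N) \<longlonglongrightarrow> min a b" by simp
    have "m N - ln 2 / real N \<le> - (1 / real N) * ln (f N + g N)" for N
    proof -
      have "0 < max (f N) (g N)" using pos[of N] by auto
      moreover have "f N + g N \<le> max (f N) (g N) * 2" by auto
      moreover have "0 < f N + g N" using pos[of N] by auto
      ultimately have "ln (f N + g N) \<le> ln (max (f N) (g N)) + ln 2"
        by (metis ln_le_cancel_iff ln_mult_pos mult_pos_pos zero_less_numeral)
      then have "1 / real N * ln (f N + g N) \<le> 1 / real N * (ln (max (f N) (g N)) + ln 2)"
        by (intro mult_left_mono) auto
      then show ?thesis unfolding m_eq by (simp add: field_simps add_divide_distrib)
    qed
    then show "\<forall>\<^sub>F N in sequentially. m N - ln 2 / real N \<le> - (1 / real N) * ln (f N + g N)"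
      by simp
    have "- (1 / real N) * ln (f N + g N) \<le> m N" for N
    proof -
      have "max (f N) (g N) \<le> f N + g N" "0 < max (f N) (g N)" using pos[of N] by auto
      then have "ln (max (f N) (g N)) \<le> ln (f N + g N)"
        by (intro ln_le_cancel_iff[THEN iffD2]) auto
      then have "1 / real N * ln (max (f N) (g N)) \<le> 1 / real N * ln (f N + g N)"
        by (intro mult_left_mono) auto
      then show ?thesis unfolding m_eq by simp
    qed
    then show "\<forall>\<^sub>F N in sequentially. - (1 / real N) * ln (f N + g N) \<le> m N"
      by simp
  qed (rule m)
  then show ?thesis
    using pos by (simp add: exp_decay_def add_pos_pos)
qed

text \<open>This is the Laplace principle for finite sums. An empty sum would be 0 and have no decay
  rate, hence the nonempty index set.\<close>

lemma exp_decay_sum: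
  assumes "finite A" "A \<noteq> {}" "\<And>i. i \<in> A \<Longrightarrow> exp_decay (\<lambda>N. f N i) (l i)"
  shows "exp_decay (\<lambda>N. \<Sum>i\<in>A. f N i) (Min (l ` A))"
  using assms by (induction rule: finite_ne_induct) (auto intro: exp_decay_add)

section \<open>In-trees as sets of edges\<close>

text \<open>A walk to \<open>y\<close> may be stopped at its first visit to \<open>y\<close>, and up
  to then it uses no edge leaving \<open>y\<close>.\<close>

lemma rtrancl_Diff_out:
  assumes "(u, y) \<in> B\<^sup>*"
  shows "(u, y) \<in> (B - {y} \<times> UNIV)\<^sup>*"
  using assms
proof (induction rule: converse_rtrancl_induct)
  case (step u v)
  then show ?case
    by (cases "u = y") (auto intro: converse_rtrancl_into_rtrancl)
qed simp

text \<open>In a functional graph the orbit of a point on a cycle never leaves the cycle: the walk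
  from \<open>z\<close> back to \<open>x\<close> must begin with the only edge out of
  \<open>z\<close>, so it passes through the successor \<open>w\<close>.\<close>

lemma single_valued_cycle_return:
  assumes "single_valued A" "(x, x) \<in> A\<^sup>+" "(x, z) \<in> A\<^sup>*"
  shows "(z, x) \<in> A\<^sup>+"
  using assms(3)
proof (induction rule: rtrancl_induct)
  case base
  then show ?case by (rule assms(2))
next
  case (step z w)
  from tranclD[OF step.IH] obtain v where v: "(z, v) \<in> A" "(v, x) \<in> A\<^sup>*" by blast
  with step.hyps(2) assms(1) have "v = w" by (auto dest: single_valuedD)
  with v assms(2) show ?case by (auto intro: rtrancl_trancl_trancl)
qed

lemma insert_out_edge_eqD:
  assumes "x \<notin> Domain A" "x \<notin> Domain A'" "insert (x, y) A = insert (x, y') A'"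
  shows "y = y'" "A = A'"
proof -
  show "y = y'" using assms by auto
  moreover have "(x, y) \<notin> A" "(x, y) \<notin> A'" using assms(1,2) by auto
  ultimately show "A = A'" using assms(3) by (simp add: insert_ident)
qed

text \<open>Arborescences as bare edge sets. A vertex other than the root has at most one exit by
  single-valuedness and at least one because it reaches the root; uniqueness of paths is then
  automatic.\<close>

definition in_trees :: "'a set \<Rightarrow> 'a rel \<Rightarrow> 'a \<Rightarrow> 'a rel set" where
  "in_trees V E x = {A. A \<subseteq> E \<and> single_valued A \<and> x \<notin> Domain A \<and> (\<forall>y\<in>V. (y, x) \<in> A\<^sup>*)}"

text \<open>The same as \<open>in_trees\<close>, except that \<open>x\<close> has an exit too. Since
  everything still leads to \<open>x\<close>, the only cycle runs through \<open>x\<close>.\<close>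

definition in_unicycles :: "'a set \<Rightarrow> 'a rel \<Rightarrow> 'a \<Rightarrow> 'a rel set" where
  "in_unicycles V E x = {B. B \<subseteq> E \<and> single_valued B \<and> x \<in> Domain B \<and> (\<forall>y\<in>V. (y, x) \<in> B\<^sup>*)}"

definition tree_sum :: "'a set \<Rightarrow> 'a rel \<Rightarrow> ('a \<times> 'a \<Rightarrow> real) \<Rightarrow> 'a \<Rightarrow> real" where
  "tree_sum V E r x = (\<Sum>A\<in>in_trees V E x. \<Prod>e\<in>A. r e)"

text \<open>Stated for arbitrary real functions, so that it also covers the unnormalised
  \<open>tree_sum\<close>.\<close>

definition balanced :: "'a set \<Rightarrow> 'a rel \<Rightarrow> ('a \<times> 'a \<Rightarrow> real) \<Rightarrow> ('a \<Rightarrow> real) \<Rightarrow> bool" where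
  "balanced V E r p \<longleftrightarrow>
     (\<forall>x\<in>V. p x * (\<Sum>y | (x, y) \<in> E. r (x, y)) = (\<Sum>y | (y, x) \<in> E. p y * r (y, x)))"

locale strong_rel =
  fixes V :: "'a set" and E :: "'a rel"
  assumes finite_V: "finite V"
    and V_nonempty: "V \<noteq> {}"
    and E_subset: "E \<subseteq> V \<times> V"
    and irrefl_E: "(x, x) \<notin> E"
    and connected: "u \<in> V \<Longrightarrow> v \<in> V \<Longrightarrow> (u, v) \<in> E\<^sup>*"
begin

lemma finite_E: "finite E"
  using finite_subset[OF E_subset] finite_V by simp

lemma finite_out: "finite {y. (x, y) \<in> E}"
  by (rule finite_subset[OF _ finite_V]) (use E_subset in auto)

lemma finite_in: "finite {y. (y, x) \<in> E}"
  by (rule finite_subset[OF _ finite_V]) (use E_subset in auto)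

lemma out_nonempty: "x \<in> V \<Longrightarrow> V \<noteq> {x} \<Longrightarrow> {y. (x, y) \<in> E} \<noteq> {}"
  using connected by (blast elim: converse_rtranclE)

lemma in_nonempty: "x \<in> V \<Longrightarrow> V \<noteq> {x} \<Longrightarrow> {y. (y, x) \<in> E} \<noteq> {}"
  using connected by (blast elim: rtranclE)

lemma finite_in_trees: "finite (in_trees V E x)"
  by (rule finite_subset[of _ "Pow E"]) (auto simp: in_trees_def finite_E)

lemma finite_in_tree: "A \<in> in_trees V E x \<Longrightarrow> finite A"
  using finite_subset[OF _ finite_E] by (auto simp: in_trees_def)

lemma prod_insert_out_edge:
  assumes "A \<in> in_trees V E x"
  shows "(\<Prod>e\<in>insert (x, y) A. r e) = (\<Prod>e\<in>A. r e) * (r (x, y) :: real)"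
proof -
  have "(x, y) \<notin> A" using assms by (auto simp: in_trees_def)
  then show ?thesis using finite_in_tree[OF assms] by (simp add: mult.commute)
qed

text \<open>A shortest-path tree: every vertex other than \<open>x\<close> points to a neighbour
  strictly closer to \<open>x\<close>.\<close>

lemma in_trees_nonempty:
  assumes x: "x \<in> V"
  shows "in_trees V E x \<noteq> {}"
proof -
  \<comment> \<open>The length of a shortest walk from \<open>y\<close> to \<open>x\<close>.\<close>
  define d where "d y = (LEAST n. (y, x) \<in> E ^^ n)" for y
  have d: "(y, x) \<in> E ^^ d y" if "y \<in> V" for y
    unfolding d_def by (rule LeastI_ex) (use connected[OF that x] in \<open>auto simp: rtrancl_power\<close>)
  have "\<exists>z. (y, z) \<in> E \<and> d z < d y" if y: "y \<in> V - {x}" for y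
  proof -
    have "d y \<noteq> 0"
    proof
      assume "d y = 0"
      with d[of y] y show False by simp
    qed
    then obtain n where n: "d y = Suc n" by (cases "d y") auto
    from d[of y] y have "(y, x) \<in> E ^^ Suc n" by (simp only: n DiffD1)
    then obtain z where z: "(y, z) \<in> E" "(z, x) \<in> E ^^ n"
      by (blast dest: relpow_Suc_D2)
    from z(2) have "d z \<le> n" unfolding d_def by (rule Least_le)
    with z n show ?thesis by auto
  qed
  then obtain f where f: "\<And>y. y \<in> V - {x} \<Longrightarrow> (y, f y) \<in> E \<and> d (f y) < d y" by metis
  let ?A = "(\<lambda>y. (y, f y)) ` (V - {x})"
  have "(y, x) \<in> ?A\<^sup>*" if "y \<in> V" for y
    using that
  proof (induction "d y" arbitrary: y rule: less_induct)
    case less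
    show ?case
    proof (cases "y = x")
      case False
      with less.prems f[of y] have "(f y, x) \<in> ?A\<^sup>*"
        using E_subset by (intro less.hyps) auto
      moreover have "(y, f y) \<in> ?A" using less.prems False by auto
      ultimately show ?thesis by (rule converse_rtrancl_into_rtrancl[rotated])
    qed simp
  qed
  moreover have "?A \<subseteq> E" using f by auto
  moreover have "single_valued ?A" by (auto simp: single_valued_def)
  ultimately have "?A \<in> in_trees V E x" by (auto simp: in_trees_def)
  then show ?thesis by blast
qed

section \<open>Two bijections from trees with an added edge onto unicycles\<close>

lemma bij_betw_out_edge:
  assumes x: "x \<in> V"
  shows "bij_betw (\<lambda>(A, y). insert (x, y) A) (in_trees V E x \<times> {y. (x, y) \<in> E}) (in_unicycles V E x)"
  unfolding bij_betw_def
proof (intro conjI)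
  show "inj_on (\<lambda>(A, y). insert (x, y) A) (in_trees V E x \<times> {y. (x, y) \<in> E})"
  proof (rule inj_onI, clarsimp)
    fix A y A' y'
    assume "A \<in> in_trees V E x" "A' \<in> in_trees V E x" "insert (x, y) A = insert (x, y') A'"
    with insert_out_edge_eqD[of x A A' y y'] show "A = A' \<and> y = y'"
      by (simp add: in_trees_def)
  qed
  show "(\<lambda>(A, y). insert (x, y) A) ` (in_trees V E x \<times> {y. (x, y) \<in> E}) = in_unicycles V E x"
  proof (intro equalityI subsetI)
    fix B assume "B \<in> (\<lambda>(A, y). insert (x, y) A) ` (in_trees V E x \<times> {y. (x, y) \<in> E})"
    then obtain A y where A: "A \<in> in_trees V E x" "(x, y) \<in> E" "B = insert (x, y) A" by auto
    then have "A\<^sup>* \<subseteq> B\<^sup>*" by (intro rtrancl_mono) auto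
    with A have "(u, x) \<in> B\<^sup>*" if "u \<in> V" for u
      using that unfolding in_trees_def by blast
    with A show "B \<in> in_unicycles V E x"
      by (auto simp: in_trees_def in_unicycles_def single_valued_def)
  next
    fix B assume B: "B \<in> in_unicycles V E x"
    then obtain y where y: "(x, y) \<in> B" by (auto simp: in_unicycles_def)
    \<comment> \<open>Deleting the exit of \<open>x\<close> undoes the insertion; walks to
      \<open>x\<close> survive because they can be stopped at their first visit to
      \<open>x\<close>.\<close>
    have "B - {x} \<times> UNIV \<in> in_trees V E x"
      using B rtrancl_Diff_out[of _ x B] by (auto simp: in_unicycles_def in_trees_def single_valued_def)
    moreover have "B = insert (x, y) (B - {x} \<times> UNIV)"
      using y B by (auto simp: in_unicycles_def single_valued_def)
    moreover have "(x, y) \<in> E" using y B by (auto simp: in_unicycles_def)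
    ultimately show "B \<in> (\<lambda>(A, y). insert (x, y) A) ` (in_trees V E x \<times> {y. (x, y) \<in> E})"
      by (intro image_eqI[of _ _ "(B - {x} \<times> UNIV, y)"]) auto
  qed
qed

text \<open>Otherwise the edge from \<open>y'\<close> would close a cycle through \<open>x\<close>.
  The orbit of \<open>x\<close> stays on that cycle, yet it must reach the root \<open>y\<close>,
  which has no exit.\<close>

lemma in_edge_unreachable:
  assumes x: "x \<in> V" and A: "A \<in> in_trees V E y" and y: "(y, x) \<in> E" and y': "(y', x) \<in> A"
  shows "(x, y') \<notin> A\<^sup>*"
proof
  assume "(x, y') \<in> A\<^sup>*"
  then have "(x, x) \<in> A\<^sup>+" using y' by (rule rtrancl_into_trancl1)
  moreover have "(x, y) \<in> A\<^sup>*" using x A by (auto simp: in_trees_def)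
  moreover have "single_valued A" using A by (simp add: in_trees_def)
  ultimately have "(y, x) \<in> A\<^sup>+" by (blast intro: single_valued_cycle_return)
  then have "y \<in> Domain A" by (auto dest: tranclD)
  with A show False by (simp add: in_trees_def)
qed

text \<open>If \<open>y \<noteq> y'\<close>, each tree contains the edge added to the other. The
  orbit of \<open>x\<close> in \<open>A\<close> never visits \<open>y'\<close>, so it avoids the
  only edge of \<open>A\<close> that may be missing from \<open>A'\<close>. It is therefore an orbit
  in \<open>A'\<close> as well and reaches \<open>y\<close> there, which
  \<open>in_edge_unreachable\<close> forbids for \<open>A'\<close>.\<close>

lemma in_edge_unique:
  assumes x: "x \<in> V"
    and A: "A \<in> in_trees V E y" "(y, x) \<in> E"
    and A': "A' \<in> in_trees V E y'" "(y', x) \<in> E"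
    and eq: "insert (y, x) A = insert (y', x) A'"
  shows "y = y'"
proof (rule ccontr)
  assume "y \<noteq> y'"
  then have e: "(y', x) \<in> A" "(y, x) \<in> A'" using eq by auto
  have "(x, z) \<in> A'\<^sup>*" if "(x, z) \<in> A\<^sup>*" for z
    using that
  proof (induction rule: rtrancl_induct)
    case (step z w)
    have "z \<noteq> y'" using step.hyps in_edge_unreachable[OF x A e(1)] by auto
    with step.hyps eq have "(z, w) \<in> A'" by auto
    with step.IH show ?case by (rule rtrancl_into_rtrancl)
  qed simp
  moreover have "(x, y) \<in> A\<^sup>*" using x A by (auto simp: in_trees_def)
  ultimately show False using in_edge_unreachable[OF x A' e(2)] by blast
qed

lemma bij_betw_in_edge:
  assumes x: "x \<in> V"
  shows "bij_betw (\<lambda>(y, A). insert (y, x) A) (SIGMA y:{y. (y, x) \<in> E}. in_trees V E y) (in_unicycles V E x)"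
  unfolding bij_betw_def
proof (intro conjI)
  show "inj_on (\<lambda>(y, A). insert (y, x) A) (SIGMA y:{y. (y, x) \<in> E}. in_trees V E y)"
  proof (rule inj_onI, clarsimp)
    fix y A y' A'
    assume a: "(y, x) \<in> E" "A \<in> in_trees V E y" "(y', x) \<in> E" "A' \<in> in_trees V E y'"
      and eq: "insert (y, x) A = insert (y', x) A'"
    have "y = y'" using in_edge_unique[OF x] a eq by blast
    with a eq insert_out_edge_eqD[of y A A' x x] show "y = y' \<and> A = A'"
      by (simp add: in_trees_def)
  qed
  show "(\<lambda>(y, A). insert (y, x) A) ` (SIGMA y:{y. (y, x) \<in> E}. in_trees V E y) = in_unicycles V E x"
  proof (intro equalityI subsetI)
    fix B assume "B \<in> (\<lambda>(y, A). insert (y, x) A) ` (SIGMA y:{y. (y, x) \<in> E}. in_trees V E y)"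
    then obtain A y where A: "A \<in> in_trees V E y" "(y, x) \<in> E" "B = insert (y, x) A" by auto
    have "(u, x) \<in> B\<^sup>*" if "u \<in> V" for u
    proof -
      have "(u, y) \<in> B\<^sup>*"
        using that A rtrancl_mono[of A B] unfolding in_trees_def by blast
      then show ?thesis using A by (auto intro: rtrancl_into_rtrancl)
    qed
    moreover have "x \<in> Domain B"
    proof -
      \<comment> \<open>Absence of loops matters here: it forces the walk from \<open>x\<close> to
        the root \<open>y\<close> to use an edge out of \<open>x\<close>.\<close>
      have "x \<noteq> y" using A irrefl_E by auto
      moreover have "(x, y) \<in> A\<^sup>*" using x A by (auto simp: in_trees_def)
      ultimately show ?thesis using A by (auto elim: converse_rtranclE)
    qed
    ultimately show "B \<in> in_unicycles V E x"
      using A by (auto simp: in_trees_def in_unicycles_def single_valued_def)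
  next
    fix B assume B: "B \<in> in_unicycles V E x"
    then obtain y1 where y1: "(x, y1) \<in> B" by (auto simp: in_unicycles_def)
    with B have "y1 \<in> V" using E_subset by (auto simp: in_unicycles_def)
    with B have "(y1, x) \<in> B\<^sup>*" by (auto simp: in_unicycles_def)
    with y1 have "(x, x) \<in> B\<^sup>+" by (rule rtrancl_into_trancl2)
    \<comment> \<open>The vertex \<open>y\<close> precedes \<open>x\<close> on the cycle. Cutting
      its exit makes it the root: every vertex reaches \<open>x\<close> and from there
      \<open>y\<close>.\<close>
    then obtain y where y: "(x, y) \<in> B\<^sup>*" "(y, x) \<in> B" by (auto dest: tranclD2)
    have "(u, y) \<in> (B - {y} \<times> UNIV)\<^sup>*" if "u \<in> V" for u
      using that B y(1) by (intro rtrancl_Diff_out) (auto simp: in_unicycles_def intro: rtrancl_trans)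
    then have "B - {y} \<times> UNIV \<in> in_trees V E y"
      using B by (auto simp: in_unicycles_def in_trees_def single_valued_def)
    moreover have "B = insert (y, x) (B - {y} \<times> UNIV)"
      using y B by (auto simp: in_unicycles_def single_valued_def)
    moreover have "(y, x) \<in> E" using y B by (auto simp: in_unicycles_def)
    ultimately show "B \<in> (\<lambda>(y, A). insert (y, x) A) ` (SIGMA y:{y. (y, x) \<in> E}. in_trees V E y)"
      by (intro image_eqI[of _ _ "(y, B - {y} \<times> UNIV)"]) auto
  qed
qed

section \<open>The Markov chain tree theorem\<close>

text \<open>Multiplied out, both sides are the total weight of \<open>in_unicycles V E x\<close>.
  This is a polynomial identity in the rates, so no sign condition on \<open>r\<close>
  appears.\<close>

lemma balanced_tree_sum: "balanced V E r (tree_sum V E r)"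
  unfolding balanced_def
proof
  fix x assume x: "x \<in> V"
  have "tree_sum V E r x * (\<Sum>y | (x, y) \<in> E. r (x, y))
      = (\<Sum>(A, y)\<in>in_trees V E x \<times> {y. (x, y) \<in> E}. (\<Prod>e\<in>A. r e) * r (x, y))"
    unfolding tree_sum_def sum_product by (rule sum.cartesian_product)
  also have "\<dots> = (\<Sum>(A, y)\<in>in_trees V E x \<times> {y. (x, y) \<in> E}. \<Prod>e\<in>insert (x, y) A. r e)"
    by (rule sum.cong) (auto simp: prod_insert_out_edge)
  also have "\<dots> = (\<Sum>B\<in>in_unicycles V E x. \<Prod>e\<in>B. r e)"
    using sum.reindex_bij_betw[OF bij_betw_out_edge[OF x], of "\<lambda>B. \<Prod>e\<in>B. r e"]
    by (simp add: case_prod_unfold)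
  also have "\<dots> = (\<Sum>(y, A)\<in>(SIGMA y:{y. (y, x) \<in> E}. in_trees V E y). \<Prod>e\<in>insert (y, x) A. r e)"
    using sum.reindex_bij_betw[OF bij_betw_in_edge[OF x], of "\<lambda>B. \<Prod>e\<in>B. r e"]
    by (simp add: case_prod_unfold)
  also have "\<dots> = (\<Sum>(y, A)\<in>(SIGMA y:{y. (y, x) \<in> E}. in_trees V E y). (\<Prod>e\<in>A. r e) * r (y, x))"
    by (rule sum.cong) (auto simp: prod_insert_out_edge)
  also have "\<dots> = (\<Sum>y | (y, x) \<in> E. tree_sum V E r y * r (y, x))"
    by (simp add: tree_sum_def sum_distrib_right sum.Sigma[symmetric] finite_in finite_in_trees)
  finally show "tree_sum V E r x * (\<Sum>y | (x, y) \<in> E. r (x, y))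
      = (\<Sum>y | (y, x) \<in> E. tree_sum V E r y * r (y, x))" .
qed

lemma tree_sum_pos:
  assumes "\<And>e. e \<in> E \<Longrightarrow> 0 < r e" "x \<in> V"
  shows "0 < tree_sum V E r x"
  unfolding tree_sum_def
  using assms in_trees_nonempty
  by (intro sum_pos finite_in_trees prod_pos) (auto simp: in_trees_def)

text \<open>A minimum principle: subtract from \<open>p\<close> the largest multiple of
  \<open>w\<close> that leaves a nonnegative remainder. The remainder has a zero, and zeros spread
  backwards along edges to all of \<open>V\<close>.\<close>

lemma balanced_unique:
  assumes r: "\<And>e. e \<in> E \<Longrightarrow> 0 < r e"
    and p: "balanced V E r p"
    and w: "balanced V E r w" "\<And>x. x \<in> V \<Longrightarrow> 0 < w x"
  obtains c where "\<And>x. x \<in> V \<Longrightarrow> p x = c * w x"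
proof -
  define c where "c = Min ((\<lambda>x. p x / w x) ` V)"
  have "c \<in> (\<lambda>x. p x / w x) ` V"
    unfolding c_def using finite_V V_nonempty by (intro Min_in) auto
  then obtain x0 where x0: "x0 \<in> V" "c = p x0 / w x0" by auto
  define g where "g x = p x - c * w x" for x
  have g_nonneg: "0 \<le> g x" if "x \<in> V" for x
  proof -
    have "c \<le> p x / w x" unfolding c_def using finite_V that by (intro Min_le) auto
    with w(2)[OF that] show ?thesis by (simp add: g_def pos_le_divide_eq)
  qed
  have g_pred: "g y = 0" if gx: "g x = 0" and yx: "(y, x) \<in> E" for x y
  proof -
    have x: "x \<in> V" using yx E_subset by auto
    \<comment> \<open>The balance equation is linear, so \<open>g\<close> satisfies it too. At a
      zero of \<open>g\<close> the inflow is 0, and since its terms are nonnegative each of them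
      vanishes.\<close>
    have "(\<Sum>z | (z, x) \<in> E. g z * r (z, x)) = g x * (\<Sum>z | (x, z) \<in> E. r (x, z))"
      using p w(1) x by (simp add: balanced_def g_def left_diff_distrib sum_subtractf
          sum_distrib_left[symmetric] mult.assoc)
    then have "(\<Sum>z | (z, x) \<in> E. g z * r (z, x)) = 0" using gx by simp
    moreover have "0 \<le> g z * r (z, x)" if "(z, x) \<in> E" for z
      using that r[OF that] E_subset by (intro mult_nonneg_nonneg g_nonneg) auto
    ultimately have "g y * r (y, x) = 0"
      using yx by (subst (asm) sum_nonneg_eq_0_iff) (auto simp: finite_in)
    with r[OF yx] show ?thesis by simp
  qed
  have "g x = 0" if "x \<in> V" for x
    using connected[OF that x0(1)]
  proof (induction rule: converse_rtrancl_induct)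
    case base
    show ?case using x0 w(2)[OF x0(1)] by (simp add: g_def)
  qed (rule g_pred)
  then show thesis by (intro that[of c]) (auto simp: g_def)
qed

theorem markov_chain_tree:
  assumes r: "\<And>e. e \<in> E \<Longrightarrow> 0 < r e"
    and p: "balanced V E r p" "(\<Sum>x\<in>V. p x) = 1"
    and x: "x \<in> V"
  shows "p x = tree_sum V E r x / (\<Sum>y\<in>V. tree_sum V E r y)"
proof -
  obtain c where c: "\<And>x. x \<in> V \<Longrightarrow> p x = c * tree_sum V E r x"
    using balanced_unique[OF r p(1) balanced_tree_sum tree_sum_pos[OF r]] by blast
  let ?Z = "\<Sum>y\<in>V. tree_sum V E r y"
  \<comment> \<open>Total mass 1 fixes the constant, and also shows that the denominator is
    nonzero.\<close>
  have Z: "c * ?Z = 1"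
    using p(2) c by (simp add: sum_distrib_left)
  have "p x * ?Z = (c * ?Z) * tree_sum V E r x"
    unfolding c[OF x] by (simp only: mult_ac)
  moreover have "?Z \<noteq> 0" using Z by (metis mult_zero_right zero_neq_one)
  ultimately show ?thesis unfolding Z by (simp add: nonzero_eq_divide_eq)
qed

section \<open>Decay rates of the invariant measure and the Hamilton--Jacobi equation\<close>

lemma exp_decay_tree_sum:
  assumes "\<And>e. e \<in> E \<Longrightarrow> exp_decay (\<lambda>N. r N e) (\<Delta> e)" "x \<in> V"
  shows "exp_decay (\<lambda>N. tree_sum V E (r N) x) (Min (sum \<Delta> ` in_trees V E x))"
  unfolding tree_sum_def
  using assms in_trees_nonempty
  by (intro exp_decay_sum exp_decay_prod finite_in_trees finite_in_tree) (auto simp: in_trees_def)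

lemma exp_decay_invariant:
  assumes r: "\<And>e. e \<in> E \<Longrightarrow> exp_decay (\<lambda>N. r N e) (\<Delta> e)"
    and p: "\<And>N. balanced V E (r N) (p N)" "\<And>N. (\<Sum>x\<in>V. p N x) = 1"
    and x: "x \<in> V"
  shows "exp_decay (\<lambda>N. p N x)
    (Min (sum \<Delta> ` in_trees V E x) - Min (\<Union>y\<in>V. sum \<Delta> ` in_trees V E y))"
proof -
  let ?m = "\<lambda>y. Min (sum \<Delta> ` in_trees V E y)"
  have fin: "finite (sum \<Delta> ` in_trees V E y)" for y
    using finite_in_trees by simp
  \<comment> \<open>The denominator yields a minimum over roots of minima over trees; it is merged
    into one minimum over all trees.\<close>
  have "Min (?m ` V) = Min (\<Union>y\<in>V. sum \<Delta> ` in_trees V E y)"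
  proof (rule antisym)
    show "Min (?m ` V) \<le> Min (\<Union>y\<in>V. sum \<Delta> ` in_trees V E y)"
    proof (rule Min.boundedI)
      fix a assume "a \<in> (\<Union>y\<in>V. sum \<Delta> ` in_trees V E y)"
      then obtain y where y: "y \<in> V" "a \<in> sum \<Delta> ` in_trees V E y" by blast
      have "Min (?m ` V) \<le> ?m y" using y finite_V by (intro Min_le) auto
      also have "\<dots> \<le> a" using y fin by (intro Min_le) auto
      finally show "Min (?m ` V) \<le> a" .
    qed (use finite_V V_nonempty in_trees_nonempty finite_in_trees in auto)
    have "Min (\<Union>y\<in>V. sum \<Delta> ` in_trees V E y) \<le> ?m y" if "y \<in> V" for y
      using that finite_V in_trees_nonempty[OF that] finite_in_trees
      by (intro Min_antimono) auto
    then show "Min (\<Union>y\<in>V. sum \<Delta> ` in_trees V E y) \<le> Min (?m ` V)"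
      using finite_V V_nonempty by (intro Min.boundedI) auto
  qed
  moreover have "exp_decay (\<lambda>N. \<Sum>y\<in>V. tree_sum V E (r N) y) (Min (?m ` V))"
    using r finite_V V_nonempty by (intro exp_decay_sum exp_decay_tree_sum)
  ultimately have "exp_decay (\<lambda>N. tree_sum V E (r N) x / (\<Sum>y\<in>V. tree_sum V E (r N) y))
      (?m x - Min (\<Union>y\<in>V. sum \<Delta> ` in_trees V E y))"
    using exp_decay_divide[OF exp_decay_tree_sum[OF r x]] by simp
  moreover have "p N x = tree_sum V E (r N) x / (\<Sum>y\<in>V. tree_sum V E (r N) y)" for N
    using r p x by (intro markov_chain_tree) (auto simp: exp_decay_def)
  ultimately show ?thesis by simp
qed

text \<open>The two sides are the decay rates of the two sides of the balance equation at
  \<open>x\<close>, and decay rates are unique. The condition \<open>V \<noteq> {x}\<close> makes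
  both edge sums nonempty.\<close>

lemma hamilton_jacobi:
  assumes r: "\<And>e. e \<in> E \<Longrightarrow> exp_decay (\<lambda>N. r N e) (\<Delta> e)"
    and p: "\<And>N. balanced V E (r N) (p N)"
    and W: "\<And>x. x \<in> V \<Longrightarrow> exp_decay (\<lambda>N. p N x) (W x)"
    and x: "x \<in> V" "V \<noteq> {x}"
  shows "W x + Min {\<Delta> (x, y) | y. (x, y) \<in> E} = Min {W y + \<Delta> (y, x) | y. (y, x) \<in> E}"
proof -
  have "exp_decay (\<lambda>N. p N x * (\<Sum>y | (x, y) \<in> E. r N (x, y)))
      (W x + Min ((\<lambda>y. \<Delta> (x, y)) ` {y. (x, y) \<in> E}))"
    using r W x finite_out out_nonempty[OF x] by (intro exp_decay_mult exp_decay_sum) auto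
  moreover have "exp_decay (\<lambda>N. \<Sum>y | (y, x) \<in> E. p N y * r N (y, x))
      (Min ((\<lambda>y. W y + \<Delta> (y, x)) ` {y. (y, x) \<in> E}))"
    using r W x E_subset finite_in in_nonempty[OF x] by (intro exp_decay_mult exp_decay_sum) auto
  moreover have "p N x * (\<Sum>y | (x, y) \<in> E. r N (x, y)) = (\<Sum>y | (y, x) \<in> E. p N y * r N (y, x))" for N
    using p x by (simp add: balanced_def)
  ultimately show ?thesis
    by (auto dest: exp_decay_unique simp: image_Collect)
qed

end

section \<open>Correspondence with the arborescences of a digraph\<close>

lemma strong_rel_pair_digraph:
  assumes "pair_digraph G" "strongly_connected (with_proj G)"
  shows "strong_rel (pverts G) (parcs G)"
proof -
  interpret pair_digraph G by fact
  show ?thesis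
  proof
    show "finite (pverts G)" by (rule pair_finite_verts)
    show "pverts G \<noteq> {}" using assms(2) by (simp add: strongly_connected_def)
    show "parcs G \<subseteq> pverts G \<times> pverts G" by (auto dest: in_arcsD1 in_arcsD2)
    show "(x, x) \<notin> parcs G" for x using pair_no_loops[of "(x, x)"] by auto
    show "(u, v) \<in> (parcs G)\<^sup>*" if "u \<in> pverts G" "v \<in> pverts G" for u v
      using assms(2) that reachable_rtranclI[of "with_proj G" u v]
      by (auto simp: strongly_connected_def)
  qed
qed

lemma pcas_imp_rtrancl: "pcas u p v \<Longrightarrow> set p \<subseteq> A \<Longrightarrow> (u, v) \<in> A\<^sup>*"
proof (induction p arbitrary: u)
  case (Cons e p)
  then show ?case by (cases e) (auto intro: converse_rtrancl_into_rtrancl)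
qed simp

text \<open>Single-valuedness forces each next edge, and since the end point \<open>x\<close> has no
  exit, neither walk can continue beyond it.\<close>

lemma pcas_unique:
  assumes "single_valued A" "x \<notin> Domain A"
    and "pcas u p x" "set p \<subseteq> A" "pcas u q x" "set q \<subseteq> A"
  shows "p = q"
  using assms(3-)
proof (induction p arbitrary: u q)
  case Nil
  with assms(2) show ?case by (cases q) auto
next
  case (Cons e p)
  have "q \<noteq> []" using Cons.prems assms(2) by (cases e) auto
  then obtain e' q' where q: "q = e' # q'" by (cases q) auto
  with Cons.prems assms(1) have "e = e'" by (cases e; cases e') (auto dest: single_valuedD)
  with Cons q show ?case by auto
qed

lemma arborescences_eq_in_trees:
  assumes G: "pair_wf_digraph G" and x: "x \<in> pverts G"
  shows "arborescences G x =
    (\<lambda>A. \<lparr>pverts = pverts G, parcs = A\<rparr>) ` in_trees (pverts G) (parcs G) x"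
proof (intro equalityI subsetI)
  interpret pair_wf_digraph G by fact
  fix \<tau> assume \<tau>: "\<tau> \<in> arborescences G x"
  then have sp: "pverts \<tau> = pverts G" "parcs \<tau> \<subseteq> parcs G"
    by (auto simp: arborescences_def spanning_def subgraph_def)
  have unique: "\<exists>!e. e \<in> out_arcs (with_proj \<tau>) y" if "y \<in> pverts G - {x}" for y
    using \<tau> that by (auto simp: arborescences_def)
  have root: "x \<notin> Domain (parcs \<tau>)"
    using \<tau> by (auto simp: arborescences_def out_arcs_def)
  have "single_valued (parcs \<tau>)"
  proof (rule single_valuedI)
    fix y a b assume ab: "(y, a) \<in> parcs \<tau>" "(y, b) \<in> parcs \<tau>"
    \<comment> \<open>Any edge of the arborescence starts at a vertex other than the root, where the
      exit is unique.\<close>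
    with sp(2) root have "y \<in> pverts G - {x}" by (auto dest: in_arcsD1)
    from unique[OF this] ab show "a = b" by (auto simp: out_arcs_def)
  qed
  moreover have "(y, x) \<in> (parcs \<tau>)\<^sup>*" if "y \<in> pverts G" for y
  proof -
    obtain p where "pre_digraph.apath (with_proj \<tau>) y p x"
      using \<tau> \<open>y \<in> pverts G\<close> by (auto simp: arborescences_def)
    then show ?thesis
      by (auto simp: pre_digraph.apath_def pre_digraph.awalk_def cas_with_proj_eq
          intro: pcas_imp_rtrancl)
  qed
  ultimately have "parcs \<tau> \<in> in_trees (pverts G) (parcs G) x"
    using sp root by (auto simp: in_trees_def)
  then show "\<tau> \<in> (\<lambda>A. \<lparr>pverts = pverts G, parcs = A\<rparr>) ` in_trees (pverts G) (parcs G) x"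
    using sp by (intro image_eqI[of _ _ "parcs \<tau>"]) auto
next
  interpret pair_wf_digraph G by fact
  fix \<tau> assume "\<tau> \<in> (\<lambda>A. \<lparr>pverts = pverts G, parcs = A\<rparr>) ` in_trees (pverts G) (parcs G) x"
  then obtain A where \<tau>: "\<tau> = \<lparr>pverts = pverts G, parcs = A\<rparr>"
    and A: "A \<subseteq> parcs G" "single_valued A" "x \<notin> Domain A" "\<And>y. y \<in> pverts G \<Longrightarrow> (y, x) \<in> A\<^sup>*"
    by (auto simp: in_trees_def)
  interpret \<tau>: pair_wf_digraph \<tau>
    by unfold_locales (simp_all add: \<tau> subsetD[OF A(1)] arc_fst_in_verts arc_snd_in_verts)
  have "spanning (with_proj \<tau>) (with_proj G)"
    using A(1) wf_digraph \<tau>.wf_digraph by (auto simp: spanning_def subgraph_def \<tau>)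
  moreover have "\<exists>!e. e \<in> out_arcs (with_proj \<tau>) y" if y: "y \<in> pverts G - {x}" for y
  proof -
    obtain z where "(y, z) \<in> A" using A(4)[of y] y by (auto elim: converse_rtranclE)
    then show ?thesis
      using A(2) by (intro ex1I[of _ "(y, z)"]) (auto simp: out_arcs_def \<tau> dest: single_valuedD)
  qed
  moreover have "out_arcs (with_proj \<tau>) x = {}"
    using A(3) by (auto simp: out_arcs_def \<tau>)
  moreover have "\<exists>!p. \<tau>.apath y p x" if y: "y \<in> pverts G" for y
  proof (rule ex_ex1I)
    have "y \<rightarrow>\<^sup>*\<^bsub>with_proj \<tau>\<^esub> x"
      using A(4)[OF y] x y \<tau>.reachable_conv by (auto simp: \<tau>)
    \<comment> \<open>A walk is shortened to a path by removing its cycles.\<close>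
    then show "\<exists>p. \<tau>.apath y p x"
      using \<tau>.reachable_awalk \<tau>.apath_awalk_to_apath by blast
    show "p = q" if "\<tau>.apath y p x" "\<tau>.apath y q x" for p q
      using that pcas_unique[OF A(2,3), of y p q]
      by (simp add: pre_digraph.apath_def pre_digraph.awalk_def cas_with_proj_eq \<tau>)
  qed
  ultimately show "\<tau> \<in> arborescences G x"
    by (simp add: arborescences_def)
qed

lemma total_weight_arborescences:
  assumes "pair_wf_digraph G" "x \<in> pverts G"
  shows "total_weight \<Delta> ` arborescences G x = sum \<Delta> ` in_trees (pverts G) (parcs G) x"
  by (simp add: arborescences_eq_in_trees[OF assms] image_image total_weight_def)

section \<open>Large deviations on a finite discrete space\<close>

text \<open>Every subset is both open and closed, and the scaled log-probability of a nonempty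
  subset converges, being that of a finite sum of point masses. Both bounds are then equalities;
  only the empty set needs separate care.\<close>

lemma ldp_discrete_topologyI:
  assumes V: "finite V"
    and \<mu>: "\<And>N. set_pmf (\<mu> N) \<subseteq> V"
    and I: "\<And>x. x \<in> V \<Longrightarrow> exp_decay (\<lambda>N. pmf (\<mu> N) x) (I x)"
    and nonneg: "\<And>x. x \<in> V \<Longrightarrow> 0 \<le> I x"
  shows "large_deviations_principle (discrete_topology V) real \<mu> (\<lambda>x. ereal (I x))"
proof -
  let ?L = "\<lambda>C N. ereal (1 / real N) * elog (measure_pmf.prob (\<mu> N) C)"
  have lim: "?L C \<longlonglongrightarrow> - (INF x\<in>C. ereal (I x))" if C: "C \<subseteq> V" "C \<noteq> {}" for C
  proof -
    have finC: "finite C" using C V finite_subset by auto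
    have "exp_decay (\<lambda>N. \<Sum>x\<in>C. pmf (\<mu> N) x) (Min (I ` C))"
      using finC C I by (intro exp_decay_sum) auto
    then have ed: "exp_decay (\<lambda>N. measure_pmf.prob (\<mu> N) C) (Min (I ` C))"
      using finC by (simp add: measure_measure_pmf_finite)
    have "(INF x\<in>C. ereal (I x)) = ereal (Min (I ` C))"
    proof (rule antisym)
      obtain x where "x \<in> C" "Min (I ` C) = I x"
        using Min_in[of "I ` C"] finC C by (metis (no_types) finite_imageI image_iff image_is_empty)
      then show "(INF x\<in>C. ereal (I x)) \<le> ereal (Min (I ` C))"
        by (auto intro: INF_lower)
      show "ereal (Min (I ` C)) \<le> (INF x\<in>C. ereal (I x))"
        using finC by (intro INF_greatest) auto
    qed
    moreover have "?L C N = - ereal (- (1 / real N) * ln (measure_pmf.prob (\<mu> N) C))" for N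
    proof -
      have "0 < measure_pmf.prob (\<mu> N) C" using ed by (simp add: exp_decay_def)
      then show ?thesis by (simp add: elog_def)
    qed
    moreover have "(\<lambda>N. - ereal (- (1 / real N) * ln (measure_pmf.prob (\<mu> N) C)))
        \<longlonglongrightarrow> - ereal (Min (I ` C))"
      using ed by (simp add: exp_decay_def tendsto_minus_cancel_left)
    ultimately show ?thesis by presburger
  qed
  have "limsup (?L C) \<le> - (INF x\<in>C. ereal (I x))" if "C \<subseteq> V" for C
  proof (cases "C = {}")
    case True
    \<comment> \<open>The index 0 is excluded because there the product is
      \<open>0 * (- \<infinity>) = 0\<close>.\<close>
    have "\<forall>\<^sub>F N in sequentially. ?L C N = - \<infinity>"
      using eventually_gt_at_top[of 0] by eventually_elim (simp add: True elog_def)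
    then have "limsup (?L C) = limsup (\<lambda>_. - \<infinity> :: ereal)" by (rule Limsup_eq)
    then show ?thesis by (simp add: Limsup_const)
  next
    case False
    show ?thesis by (simp add: lim_imp_Limsup[OF _ lim[OF that False]])
  qed
  moreover have "- (INF x\<in>C. ereal (I x)) \<le> liminf (?L C)" if "C \<subseteq> V" for C
  proof (cases "C = {}")
    case False
    show ?thesis by (simp add: lim_imp_Liminf[OF _ lim[OF that False]])
  qed (simp add: top_ereal_def)
  ultimately show ?thesis
    using \<mu> nonneg
    by (auto simp: large_deviations_principle_def rate_functional_def filterlim_real_sequentially)
qed

section \<open>Assembly of the large deviations principle and the Hamilton--Jacobi equation\<close>

theorem lemma3p2:
  fixes G :: "'a pair_pre_digraph"
    and r :: "nat \<Rightarrow> 'a \<times> 'a \<Rightarrow> real"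
    and \<Delta> :: "'a \<times> 'a \<Rightarrow> real"
    and \<pi> :: "nat \<Rightarrow> 'a pmf"
  assumes "pair_digraph G"
    and "strongly_connected (with_proj G)"
    and "\<And>N e. e \<in> parcs G \<Longrightarrow> 0 < r N e"
    and "\<And>e. e \<in> parcs G \<Longrightarrow> (\<lambda>N. - (1 / real N) * ln (r N e)) \<longlonglongrightarrow> \<Delta> e"
    and "\<And>e. e \<in> parcs G \<Longrightarrow> 0 \<le> \<Delta> e"
    and "\<And>N. invariant_measure G (r N) (\<pi> N)"
  shows "large_deviations_principle (discrete_topology (pverts G)) real \<pi> (\<lambda>x. ereal (FW \<pi> x)) \<and>
    (\<forall>x \<in> pverts G.
       (\<lambda>N. - (1 / real N) * ln (pmf (\<pi> N) x)) \<longlonglongrightarrow> FW \<pi> x \<and>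
       FW \<pi> x = Min (total_weight \<Delta> ` arborescences G x)
              - Min (total_weight \<Delta> ` all_arborescences G)) \<and>
    solves_discrete_HJ G \<Delta> (FW \<pi>)"
proof -
  let ?V = "pverts G" and ?E = "parcs G"
  interpret G: strong_rel ?V ?E
    by (rule strong_rel_pair_digraph) fact+
  have wf: "pair_wf_digraph G"
    using assms(1) by (simp add: pair_digraph_def pair_fin_digraph_def)
  have r: "exp_decay (\<lambda>N. r N e) (\<Delta> e)" if "e \<in> ?E" for e
    using assms(3,4) that by (simp add: exp_decay_def)
  have supp: "set_pmf (\<pi> N) \<subseteq> ?V" and bal: "balanced ?V ?E (r N) (pmf (\<pi> N))" for N
    using assms(6)[of N] by (auto simp: invariant_measure_def balanced_def)
  have mass: "(\<Sum>x\<in>?V. pmf (\<pi> N) x) = 1" for N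
    using supp G.finite_V by (rule sum_pmf_eq_1[rotated])
  let ?W = "\<lambda>x. Min (total_weight \<Delta> ` arborescences G x) - Min (total_weight \<Delta> ` all_arborescences G)"
  have all: "total_weight \<Delta> ` all_arborescences G = (\<Union>y\<in>?V. sum \<Delta> ` in_trees ?V ?E y)"
    using total_weight_arborescences[OF wf] by (simp add: all_arborescences_def image_UN)
  have W: "exp_decay (\<lambda>N. pmf (\<pi> N) x) (?W x)" if "x \<in> ?V" for x
    using G.exp_decay_invariant[OF r bal mass that]
    by (simp only: total_weight_arborescences[OF wf that] all)
  have FW: "FW \<pi> x = ?W x" if "x \<in> ?V" for x
    unfolding FW_def by (rule limI) (use W[OF that] in \<open>simp add: exp_decay_def\<close>)
  have decay: "exp_decay (\<lambda>N. pmf (\<pi> N) x) (FW \<pi> x)" if "x \<in> ?V" for x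
    using W[OF that] FW[OF that] by simp
  have "0 \<le> FW \<pi> x" if "x \<in> ?V" for x
  proof -
    \<comment> \<open>Nonnegativity of the rate: trees rooted at \<open>x\<close> are among all
      trees.\<close>
    have "Min (total_weight \<Delta> ` all_arborescences G) \<le> Min (total_weight \<Delta> ` arborescences G x)"
      unfolding total_weight_arborescences[OF wf that] all
      using that G.finite_V G.in_trees_nonempty[OF that] G.finite_in_trees
      by (intro Min_antimono) auto
    then show ?thesis by (simp add: FW[OF that])
  qed
  then have "large_deviations_principle (discrete_topology ?V) real \<pi> (\<lambda>x. ereal (FW \<pi> x))"
    using G.finite_V supp decay by (intro ldp_discrete_topologyI)
  moreover have "solves_discrete_HJ G \<Delta> (FW \<pi>)"
    unfolding solves_discrete_HJ_def
  proof
    fix x assume x: "x \<in> ?V"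
    show "FW \<pi> x + Min {\<Delta> (x, y) | y. (x, y) \<in> ?E} = Min {FW \<pi> y + \<Delta> (y, x) | y. (y, x) \<in> ?E}"
    proof (cases "?V = {x}")
      case True
      \<comment> \<open>With a single vertex there are no edges, so both sides contain the same
        unspecified \<open>Min {}\<close>. The equation then reduces to
        \<open>FW \<pi> x = 0\<close>, which holds as all trees are rooted at
        \<open>x\<close>.\<close>
      then have "?E \<subseteq> {(x, x)}" using G.E_subset by auto
      then have "?E = {}" using G.irrefl_E by auto
      moreover have "FW \<pi> x = 0" using FW[OF x] True by (simp add: all_arborescences_def)
      ultimately show ?thesis by simp
    qed (rule G.hamilton_jacobi[OF r bal decay x])
  qed
  ultimately show ?thesis
    using decay FW by (auto simp: exp_decay_def)
qed

end
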